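(* Let $f:(\mathbb{R}^n\setminus\mathcal{C})\times U\to\mathbb{R}^n$ be continuous and satisfy hypothesis $(\mathrm{Hg})$ stated in the context, with associated rescaled dynamics $\bar f$, extended dynamics $F$ and extended control set $\overline{\mathbb{U}}$. If the rescaled system $y'=\bar f(y,v)$, $v\in U$, is GAC to $\mathcal{C}$, then the extended system $y'=F(y,w_0,w)$, $(w_0,w)\in\overline{\mathbb{U}}$, is GAC to $\mathcal{C}$.
   Context: Standing setting. $\mathcal{C}\subset\mathbb{R}^n$ is a nonempty closed set with compact boundary, $U\subseteq\mathbb{R}^m$ is a closed cone, $\mathbf d(x):=\mathrm{dist}(x,\mathcal{C})$ is the Euclidean distance from $\mathcal{C}$, and $B_R(\mathcal{C}):=\{x\in\mathbb{R}^n:\mathbf d(x)\le R\}$. Hypothesis $(\mathrm{Hg})$. There is a strictly increasing bijection $\nu:[0,+\infty)\to[0,+\infty)$ (growth rate) such that: (i) $\bar f(x,u):=\frac{f(x,u)}{1+\nu(|u|)}$ is uniformly continuous on $\mathcal{K}\times U$ for every compact $\mathcal{K}\subset\mathbb{R}^n\setminus\mathcal{C}$, and bounded on $(B_R(\mathcal{C})\setminus\mathcal{C})\times U$ for every $R>0$; (ii) letting $\mathbb{U}:=\{(w_0,w)\in(0,+\infty)\times U:\ w_0+|w|=1\}$ and $\overline{\mathbb{U}}$ its closure, the extended dynamics $$F(x,w_0,w):=\lim_{r\to w_0^+}\bar f\Big(x,\tfrac{w}{|w|}\,\nu^{-1}\big(\tfrac{|w|}{r}\big)\Big)=\lim_{r\to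 w_0^+}f\Big(x,\tfrac{w}{|w|}\,\nu^{-1}\big(\tfrac{|w|}{r}\big)\Big)\,r$$ (with $\frac{w}{|w|}:=0$ if $w=0$; extended by continuity to $x\in\partial(\mathbb{R}^n\setminus\mathcal{C})$) is well defined, not identically zero, continuous and locally bounded on $\overline{(\mathbb{R}^n\setminus\mathcal{C})}\times\overline{\mathbb{U}}$. In the following definitions $(g,V)$ denotes a nonempty closed set $V\subseteq\mathbb{R}^M$ and a continuous function $g:(\mathbb{R}^n\setminus\mathcal{C})\times V\to\mathbb{R}^n$; they are applied to $(\bar f,U)$ and $(F,\overline{\mathbb{U}})$. $\mathcal{KL}$ functions (descent rates): continuous $\beta:[0,+\infty)^2\to[0,+\infty)$ such that $\beta(0,t)=0$ and $\beta(\cdot,t)$ is strictly increasing and unbounded for each $t\ge0$; $\beta(r,\cdot)$ is strictly decreasing for each $r>0$; $\beta(r,t)\to0$ as $t\to+\infty$ for each $r\ge0$. Admissible pair for $(g,V)$: a pair $(x,u)$ for which there is $T_x\in(0,+\infty]$ such that $u\in L^\infty_{loc}([0,T_x),V)$ (essentially bounded on compact subsets), $x:[0,T_x)\to\mathbb{R}^n\setminus\mathcal{C}$ is locally absolutely continuous, $\dot x(t)=g(x(t),u(t))$ for a.e. $t\in[0,T_x)$, and, if $T_x<+\infty$, $\lim_{t\to T_x^-}\mathbf d(x(t))=0$. If $T_x<+\infty$, $x$ is extended to $[0,+\infty)$ by setting $x(t):=\bar z$ for $t\ge T_x$, where $\bar z\in\partial\mathcal{C}$ is an arbitrary point of the form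 $\bar z=\lim_i x(\tau_i)$ for some $\tau_i\uparrow T_x$. GAC. The system $\dot x=g(x,u)$, $u\in V$, is globally asymptotically controllable (GAC) to $\mathcal{C}$ if there is $\beta\in\mathcal{KL}$ such that for every $z\in\mathbb{R}^n\setminus\mathcal{C}$ there is an admissible pair $(x,u)$ for $(g,V)$ with $x(0)=z$ and $\mathbf d(x(t))\le\beta(\mathbf d(z),t)$ for all $t\ge0$. *)

theory Defs
  imports "HOL-Analysis.Analysis"
begin

section \<open>Comparison functions\<close>

definition KL_fun :: "(real \<Rightarrow> real \<Rightarrow> real) \<Rightarrow> bool" where
  "KL_fun \<beta> \<longleftrightarrow>
     continuous_on ({0..} \<times> {0..}) (\<lambda>(r, t). \<beta> r t) \<and>
     (\<forall>r\<ge>0. \<forall>t\<ge>0. \<beta> r t \<ge> 0) \<and>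
     (\<forall>t\<ge>0. \<beta> 0 t = 0 \<and> strict_mono_on {0..} (\<lambda>r. \<beta> r t) \<and> \<not> bounded ((\<lambda>r. \<beta> r t) ` {0..})) \<and>
     (\<forall>r>0. strict_antimono_on {0..} (\<beta> r)) \<and>
     (\<forall>r\<ge>0. (\<beta> r \<longlongrightarrow> 0) at_top)"

section \<open>Admissible pairs\<close>

definition time_dom :: "ereal \<Rightarrow> real set" where
  "time_dom T = {t. 0 \<le> t \<and> ereal t < T}"

text \<open>A finite family of intervals with pairwise disjoint interiors is encoded by the finite set
  \<open>P\<close> of its pairs of endpoints.\<close>

definition abs_continuous_on_interval :: "real \<Rightarrow> real \<Rightarrow> (real \<Rightarrow> 'a::real_normed_vector) \<Rightarrow> bool" where
  "abs_continuous_on_interval a b x \<longleftrightarrow>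
     (\<forall>\<epsilon>>0. \<exists>\<delta>>0. \<forall>P :: (real \<times> real) set.
        finite P \<longrightarrow> (\<forall>(s, t)\<in>P. a \<le> s \<and> s \<le> t \<and> t \<le> b) \<longrightarrow>
        disjoint_family_on (\<lambda>(s, t). {s<..<t}) P \<longrightarrow>
        (\<Sum>(s, t)\<in>P. t - s) < \<delta> \<longrightarrow>
        (\<Sum>(s, t)\<in>P. norm (x t - x s)) < \<epsilon>)"

definition locally_abs_continuous_on :: "real set \<Rightarrow> (real \<Rightarrow> 'a::real_normed_vector) \<Rightarrow> bool" where
  "locally_abs_continuous_on I x \<longleftrightarrow>
     (\<forall>a b. a \<le> b \<longrightarrow> {a..b} \<subseteq> I \<longrightarrow> abs_continuous_on_interval a b x)"

definition Linf_loc :: "real set \<Rightarrow> 'v::euclidean_space set \<Rightarrow> (real \<Rightarrow> 'v) set" where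
  "Linf_loc I V =
     {u. u \<in> borel_measurable (lebesgue_on I) \<and> (\<forall>t\<in>I. u t \<in> V) \<and>
         (\<forall>K. compact K \<longrightarrow> K \<subseteq> I \<longrightarrow> (\<exists>M. AE t in lebesgue_on K. norm (u t) \<le> M))}"

definition admissible_pair ::
  "'a::euclidean_space set \<Rightarrow> ('a \<Rightarrow> 'v::euclidean_space \<Rightarrow> 'a) \<Rightarrow> 'v set \<Rightarrow> ereal \<Rightarrow>
   (real \<Rightarrow> 'a) \<Rightarrow> (real \<Rightarrow> 'v) \<Rightarrow> bool" where
  "admissible_pair C g V T x u \<longleftrightarrow>
     0 < T \<and>
     u \<in> Linf_loc (time_dom T) V \<and>
     x ` time_dom T \<subseteq> - C \<and>
     locally_abs_continuous_on (time_dom T) x \<and>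
     (AE t in lebesgue_on (time_dom T).
        (x has_vector_derivative g (x t) (u t)) (at t within time_dom T)) \<and>
     (T < \<infinity> \<longrightarrow> ((\<lambda>t. infdist (x t) C) \<longlongrightarrow> 0) (at_left (real_of_ereal T)))"

text \<open>The values of \<open>x\<close> on \<open>[T, \<infinity>)\<close>, irrelevant for \<open>admissible_pair\<close>, are those of
  the constant extension of the trajectory, for some choice of the limit point \<open>z\<close>.\<close>

definition extended_after :: "'a::euclidean_space set \<Rightarrow> ereal \<Rightarrow> (real \<Rightarrow> 'a) \<Rightarrow> bool" where
  "extended_after C T x \<longleftrightarrow>
     (T < \<infinity> \<longrightarrow>
       (\<exists>z\<in>frontier C.
          (\<exists>\<tau>. range \<tau> \<subseteq> time_dom T \<and> incseq \<tau> \<and> \<tau> \<longlonglongrightarrow> real_of_ereal T \<and>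
               (\<lambda>i. x (\<tau> i)) \<longlonglongrightarrow> z) \<and>
          (\<forall>t\<ge>real_of_ereal T. x t = z)))"

section \<open>Global asymptotic controllability\<close>

definition GAC ::
  "'a::euclidean_space set \<Rightarrow> ('a \<Rightarrow> 'v::euclidean_space \<Rightarrow> 'a) \<Rightarrow> 'v set \<Rightarrow> bool" where
  "GAC C g V \<longleftrightarrow>
     (\<exists>\<beta>. KL_fun \<beta> \<and>
        (\<forall>z\<in>- C. \<exists>T x u. admissible_pair C g V T x u \<and> extended_after C T x \<and>
           x 0 = z \<and> (\<forall>t\<ge>0. infdist (x t) C \<le> \<beta> (infdist z C) t)))"

section \<open>Rescaled and extended dynamics\<close>

definition rescaled_dyn ::
  "('a::euclidean_space \<Rightarrow> 'u::euclidean_space \<Rightarrow> 'a) \<Rightarrow> (real \<Rightarrow> real) \<Rightarrow> 'a \<Rightarrow> 'u \<Rightarrow> 'a" where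
  "rescaled_dyn f \<nu> x u = f x u /\<^sub>R (1 + \<nu> (norm u))"

definition ext_controls :: "'u::euclidean_space set \<Rightarrow> (real \<times> 'u) set" where
  "ext_controls U = closure {(w0, w). 0 < w0 \<and> w \<in> U \<and> w0 + norm w = 1}"

text \<open>Since \<open>inverse 0 = 0\<close>, the direction \<open>w /\<^sub>R norm w\<close> is \<open>0\<close> for \<open>w = 0\<close>.\<close>

definition unscaled_control :: "(real \<Rightarrow> real) \<Rightarrow> 'u::euclidean_space \<Rightarrow> real \<Rightarrow> 'u" where
  "unscaled_control \<nu> w r = inv_into {0..} \<nu> (norm w / r) *\<^sub>R (w /\<^sub>R norm w)"

definition ext_dyn_off ::
  "('a::euclidean_space \<Rightarrow> 'u::euclidean_space \<Rightarrow> 'a) \<Rightarrow> (real \<Rightarrow> real) \<Rightarrow> 'a \<Rightarrow> real \<times> 'u \<Rightarrow> 'a" where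
  "ext_dyn_off f \<nu> x = (\<lambda>(w0, w).
     Lim (at_right w0) (\<lambda>r. rescaled_dyn f \<nu> x (unscaled_control \<nu> w r)))"

text \<open>On the boundary of \<open>- C\<close> the values are obtained by passing to the limit from \<open>- C\<close>.
  Existence of the limits is not part of the definitions: it is demanded in \<open>Hg\<close>, on the
  boundary through the continuity requirement.\<close>

definition ext_dyn ::
  "'a::euclidean_space set \<Rightarrow> ('a \<Rightarrow> 'u::euclidean_space \<Rightarrow> 'a) \<Rightarrow> (real \<Rightarrow> real) \<Rightarrow>
   'a \<Rightarrow> real \<times> 'u \<Rightarrow> 'a" where
  "ext_dyn C f \<nu> x p =
     (if x \<in> - C then ext_dyn_off f \<nu> x p
      else Lim (at x within - C) (\<lambda>y. ext_dyn_off f \<nu> y p))"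

definition growth_rate :: "(real \<Rightarrow> real) \<Rightarrow> bool" where
  "growth_rate \<nu> \<longleftrightarrow> strict_mono_on {0..} \<nu> \<and> bij_betw \<nu> {0..} {0..}"

definition Hg ::
  "'a::euclidean_space set \<Rightarrow> 'u::euclidean_space set \<Rightarrow> ('a \<Rightarrow> 'u \<Rightarrow> 'a) \<Rightarrow> (real \<Rightarrow> real) \<Rightarrow> bool" where
  "Hg C U f \<nu> \<longleftrightarrow>
     growth_rate \<nu> \<and>
     (\<forall>K. compact K \<longrightarrow> K \<subseteq> - C \<longrightarrow>
        uniformly_continuous_on (K \<times> U) (\<lambda>(x, u). rescaled_dyn f \<nu> x u)) \<and>
     (\<forall>R>0. bounded ((\<lambda>(x, u). rescaled_dyn f \<nu> x u) ` (({x. infdist x C \<le> R} - C) \<times> U))) \<and>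
     (\<forall>x\<in>- C. \<forall>(w0, w)\<in>ext_controls U. \<exists>L.
        ((\<lambda>r. rescaled_dyn f \<nu> x (unscaled_control \<nu> w r)) \<longlongrightarrow> L) (at_right w0) \<and>
        ((\<lambda>r. r *\<^sub>R f x (unscaled_control \<nu> w r)) \<longlongrightarrow> L) (at_right w0)) \<and>
     (\<exists>x\<in>closure (- C). \<exists>p\<in>ext_controls U. ext_dyn C f \<nu> x p \<noteq> 0) \<and>
     continuous_on (closure (- C) \<times> ext_controls U) (\<lambda>(x, p). ext_dyn C f \<nu> x p) \<and>
     (\<forall>q\<in>closure (- C) \<times> ext_controls U. \<exists>r>0.
        bounded ((\<lambda>(x, p). ext_dyn C f \<nu> x p) ` (ball q r \<inter> closure (- C) \<times> ext_controls U)))"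

end

theory Submission
  imports Defs
begin

text \<open>Every control value \<open>v \<in> U\<close> of the rescaled system has a counterpart
  \<open>(w0, w)\<close> with \<open>w0 > 0\<close> in the extended control set, determined by
  \<open>norm w / w0 = \<nu> (norm v)\<close> and \<open>w0 + norm w = 1\<close>, at which the extended dynamics
  takes the value of the rescaled one.  Hence every rescaled trajectory is an extended
  trajectory, with the same descent rate.\<close>

text \<open>A monotone function with open range has no jumps. Extending \<open>g\<close> by the
  identity to the negative reals gives a monotone map \<open>h\<close> onto the whole line, whose
  range is trivially open.\<close>

lemma continuous_on_strict_mono_bij_atLeast_0:
  fixes g :: "real \<Rightarrow> real"
  assumes mono: "strict_mono_on {0..} g" and bij: "bij_betw g {0..} {0..}"
  shows "continuous_on {0..} g"
proof -
  define h where "h x = (if 0 \<le> x then g x else x)" for x :: real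
  have g_nonneg: "0 \<le> g x" if "0 \<le> x" for x
    using bij_betwE[OF bij] that by auto
  have "y \<in> range h" for y
  proof (cases "0 \<le> y")
    case True
    then have "y \<in> g ` {0..}" using bij by (simp add: bij_betw_def)
    then obtain x where "0 \<le> x" "g x = y" by auto
    then show ?thesis by (metis h_def rangeI)
  next
    case False
    then have "h y = y" by (simp add: h_def)
    then show ?thesis by (metis rangeI)
  qed
  then have "range h = UNIV" by auto
  moreover have "h x \<le> h y" if "x \<le> y" for x y
    using that g_nonneg[of y] strict_mono_on_leD[OF mono, of x y] by (auto simp: h_def)
  ultimately have "continuous_on UNIV h"
    by (intro continuous_onI_mono) auto
  then have "continuous_on {0..} h" by (rule continuous_on_subset) simp
  then show ?thesis
    by (rule continuous_on_eq) (simp add: h_def)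
qed

context
  fixes \<nu> :: "real \<Rightarrow> real"
  assumes growth: "growth_rate \<nu>"
begin

lemma growth_rate_nonneg: "0 \<le> s \<Longrightarrow> 0 \<le> \<nu> s"
  using growth bij_betwE unfolding growth_rate_def by fastforce

lemma growth_rate_0: "\<nu> 0 = 0"
proof -
  have "0 \<in> \<nu> ` {0..}" using growth by (simp add: growth_rate_def bij_betw_def)
  then obtain s where s: "0 \<le> s" "\<nu> s = 0" by auto
  then have "\<nu> 0 \<le> \<nu> s"
    using growth strict_mono_on_leD[of "{0..}" \<nu> 0 s] by (simp add: growth_rate_def)
  with s growth_rate_nonneg[of 0] show ?thesis by simp
qed

lemma continuous_on_growth_rate: "continuous_on {0..} \<nu>"
  using growth continuous_on_strict_mono_bij_atLeast_0 by (simp add: growth_rate_def)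

lemma inv_into_growth_rate: "0 \<le> s \<Longrightarrow> inv_into {0..} \<nu> (\<nu> s) = s"
  using growth by (auto simp: growth_rate_def bij_betw_def)

text \<open>The inverse is again a strictly increasing bijection of the half-line. Its continuity is
  what allows limits to pass through \<open>unscaled_control\<close>.\<close>

lemma continuous_on_inv_growth_rate: "continuous_on {0..} (inv_into {0..} \<nu>)"
proof (rule continuous_on_strict_mono_bij_atLeast_0)
  have bij: "bij_betw \<nu> {0..} {0..}" and mono: "strict_mono_on {0..} \<nu>"
    using growth by (auto simp: growth_rate_def)
  show bij': "bij_betw (inv_into {0..} \<nu>) {0..} {0..}"
    using bij by (rule bij_betw_inv_into)
  show "strict_mono_on {0..} (inv_into {0..} \<nu>)"
  proof (rule strict_mono_onI)
    fix a b :: real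
    assume ab: "a \<in> {0..}" "b \<in> {0..}" "a < b"
    let ?a = "inv_into {0..} \<nu> a" and ?b = "inv_into {0..} \<nu> b"
    have "?a \<in> {0..}" "?b \<in> {0..}"
      using ab bij_betwE[OF bij'] by auto
    moreover have "\<nu> ?a = a" "\<nu> ?b = b"
      using ab bij by (auto intro: bij_betw_inv_into_right)
    ultimately show "?a < ?b"
      using ab strict_mono_on_leD[OF mono, of ?b ?a] by fastforce
  qed
qed

text \<open>The solution of the two equations for \<open>(w0, w)\<close> with \<open>w\<close>
  pointing along \<open>v\<close>. As \<open>sgn 0 = 0\<close> and \<open>\<nu> 0 = 0\<close>, the
  control \<open>v = 0\<close> is sent to \<open>(1, 0)\<close>.\<close>

definition lift_control :: "'u::euclidean_space \<Rightarrow> real \<times> 'u" where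
  "lift_control v = (1 / (1 + \<nu> (norm v)), (\<nu> (norm v) / (1 + \<nu> (norm v))) *\<^sub>R sgn v)"

lemma norm_snd_lift_control: "norm (snd (lift_control v)) = \<nu> (norm v) / (1 + \<nu> (norm v))"
  \<comment> \<open>For \<open>v = 0\<close> the factor \<open>sgn v\<close> has norm 0 instead of
    1; the formula survives because \<open>\<nu> 0 = 0\<close>.\<close>
  using growth_rate_nonneg[of "norm v"] growth_rate_0
  by (simp add: lift_control_def norm_sgn)

lemma lift_control_in_ext_controls:
  assumes "cone U" "v \<in> U"
  shows "lift_control v \<in> ext_controls U"
proof -
  have pos: "0 < 1 + \<nu> (norm v)" using growth_rate_nonneg[of "norm v"] by simp
  have "fst (lift_control v) + norm (snd (lift_control v)) = 1"
    unfolding norm_snd_lift_control using pos by (simp add: lift_control_def field_simps)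
  moreover have "snd (lift_control v) \<in> U"
    unfolding lift_control_def sgn_div_norm
    using assms growth_rate_nonneg[of "norm v"] by (auto intro!: mem_cone)
  moreover have "0 < fst (lift_control v)" using pos by (simp add: lift_control_def)
  ultimately show ?thesis
    unfolding ext_controls_def by (intro subsetD[OF closure_subset]) (auto simp: case_prod_beta)
qed

text \<open>Provides the essential bound that \<open>Linf_loc\<close> asks of a lifted control, the
  same for every compact set of times.\<close>

lemma norm_lift_control_le: "norm (lift_control v) \<le> 2"
proof -
  have "0 \<le> \<nu> (norm v)" using growth_rate_nonneg by simp
  then have "norm (fst (lift_control v)) \<le> 1" "norm (snd (lift_control v)) \<le> 1"
    unfolding norm_snd_lift_control by (simp_all add: lift_control_def)
  then show ?thesis
    using norm_Pair_le[of "fst (lift_control v)" "snd (lift_control v)"] by simp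
qed

lemma borel_measurable_lift_control: "lift_control \<in> borel_measurable borel"
proof -
  \<comment> \<open>\<open>\<nu>\<close> is constrained only on \<open>{0..}\<close>, so continuity
    on the whole space is available only after composing with the norm.\<close>
  have "continuous_on UNIV (\<lambda>v :: 'a. \<nu> (norm v))"
    by (rule continuous_on_compose2[OF continuous_on_growth_rate]) (auto intro: continuous_intros)
  then have [measurable]: "(\<lambda>v :: 'a. \<nu> (norm v)) \<in> borel_measurable borel"
    by (rule borel_measurable_continuous_onI)
  show ?thesis
    unfolding lift_control_def[abs_def] sgn_div_norm by measurable
qed

text \<open>As r decreases to w0, the quotient \<open>norm w / r\<close> tends to
  \<open>\<nu> (norm v)\<close>, so the inverse of \<open>\<nu>\<close> recovers the length of
  \<open>v\<close>, while \<open>w\<close> has kept its direction.\<close>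

lemma unscaled_control_lift_tendsto:
  "((\<lambda>r. unscaled_control \<nu> (snd (lift_control v)) r) \<longlongrightarrow> v) (at_right (fst (lift_control v)))"
proof -
  define w0 w where "w0 = fst (lift_control v)" and "w = snd (lift_control v)"
  have \<nu>: "0 \<le> \<nu> (norm v)" using growth_rate_nonneg by simp
  then have w0: "0 < w0" by (simp add: w0_def lift_control_def)
  have ratio: "norm w / w0 = \<nu> (norm v)"
    unfolding w_def norm_snd_lift_control using \<nu> by (simp add: w0_def lift_control_def)
  have "((\<lambda>r. norm w / r) \<longlongrightarrow> \<nu> (norm v)) (at_right w0)"
    unfolding ratio[symmetric] using w0 by (intro tendsto_intros) auto
  \<comment> \<open>The inverse is continuous only on \<open>{0..}\<close>, so its argument has to
    stay there. The right end \<open>w0 + 1\<close> is arbitrary: positivity of r is enough.\<close>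
  moreover have "\<forall>\<^sub>F r in at_right w0. norm w / r \<in> {0..}"
    using w0 by (auto simp: eventually_at_right_field intro!: exI[of _ "w0 + 1"])
  ultimately have "((\<lambda>r. inv_into {0..} \<nu> (norm w / r)) \<longlongrightarrow> inv_into {0..} \<nu> (\<nu> (norm v))) (at_right w0)"
    using \<nu> by (intro continuous_on_tendsto_compose[OF continuous_on_inv_growth_rate]) auto
  then have lim: "((\<lambda>r. unscaled_control \<nu> w r) \<longlongrightarrow> norm v *\<^sub>R (w /\<^sub>R norm w)) (at_right w0)"
    unfolding unscaled_control_def by (intro tendsto_intros) (simp add: inv_into_growth_rate)
  have "norm v *\<^sub>R (w /\<^sub>R norm w) = v"
  proof (cases "v = 0")
    case False
    \<comment> \<open>Injectivity: applying the inverse to \<open>\<nu> (norm v) = \<nu> 0\<close>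
      would give \<open>norm v = 0\<close>.\<close>
    have "\<nu> (norm v) \<noteq> 0"
      using False inv_into_growth_rate[of "norm v"] inv_into_growth_rate[of 0] growth_rate_0 by auto
    then have "norm w \<noteq> 0"
      using ratio by auto
    moreover have "w = norm w *\<^sub>R sgn v"
      unfolding w_def norm_snd_lift_control by (simp add: lift_control_def)
    ultimately have "w /\<^sub>R norm w = sgn v"
      by (metis left_inverse scaleR_one scaleR_scaleR)
    then show ?thesis using False by (simp add: sgn_div_norm)
  qed simp
  with lim show ?thesis by (simp add: w0_def w_def)
qed

text \<open>The limit that defines the extended dynamics runs along controls in \<open>U\<close>
  converging to \<open>v\<close>, so continuity of the rescaled dynamics in the control evaluates
  it.\<close>

lemma ext_dyn_lift_control:
  fixes U :: "'u::euclidean_space set" and f :: "'a::euclidean_space \<Rightarrow> 'u \<Rightarrow> 'a"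
  assumes "cone U" "v \<in> U" "x \<in> - C"
    and cont: "continuous_on U (rescaled_dyn f \<nu> x)"
  shows "ext_dyn C f \<nu> x (lift_control v) = rescaled_dyn f \<nu> x v"
proof -
  define w0 w where "w0 = fst (lift_control v)" and "w = snd (lift_control v)"
  have w: "w \<in> U"
    unfolding w_def lift_control_def sgn_div_norm
    using assms growth_rate_nonneg[of "norm v"] by (auto intro!: mem_cone)
  have w0: "0 < w0"
    using growth_rate_nonneg[of "norm v"] by (simp add: w0_def lift_control_def)
  \<comment> \<open>Continuity is known only on \<open>U\<close>, so the approximating controls must
    lie there; they are nonnegative multiples of \<open>w\<close>, and \<open>U\<close> is a
    cone.\<close>
  have in_U: "unscaled_control \<nu> w r \<in> U" if "w0 < r" for r
  proof -
    have "norm w / r \<in> \<nu> ` {0..}"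
      using growth that w0 by (simp add: growth_rate_def bij_betw_def)
    from inv_into_into[OF this] have "0 \<le> inv_into {0..} \<nu> (norm w / r)" by simp
    moreover have "w /\<^sub>R norm w \<in> U"
      using w \<open>cone U\<close> by (simp add: mem_cone)
    ultimately show ?thesis
      unfolding unscaled_control_def by (blast intro: mem_cone[OF \<open>cone U\<close>])
  qed
  have "((\<lambda>r. rescaled_dyn f \<nu> x (unscaled_control \<nu> w r)) \<longlongrightarrow> rescaled_dyn f \<nu> x v) (at_right w0)"
    using unscaled_control_lift_tendsto[of v] \<open>v \<in> U\<close> in_U
    by (intro continuous_on_tendsto_compose[OF cont])
      (auto simp: w0_def w_def eventually_at_right_field intro!: exI[of _ "w0 + 1"])
  then have "ext_dyn_off f \<nu> x (w0, w) = rescaled_dyn f \<nu> x v"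
    unfolding ext_dyn_off_def by (simp add: tendsto_Lim)
  with \<open>x \<in> - C\<close> show ?thesis by (simp add: ext_dyn_def w0_def w_def)
qed

text \<open>The time \<open>T\<close> and the trajectory \<open>x\<close> are kept, so only the
  conditions on the control and the differential equation have to be checked again.\<close>

lemma admissible_pair_lift_control:
  fixes U :: "'u::euclidean_space set" and f :: "'a::euclidean_space \<Rightarrow> 'u \<Rightarrow> 'a"
  assumes "cone U"
    and cont: "\<And>x. x \<in> - C \<Longrightarrow> continuous_on U (rescaled_dyn f \<nu> x)"
    and adm: "admissible_pair C (rescaled_dyn f \<nu>) U T x u"
  shows "admissible_pair C (ext_dyn C f \<nu>) (ext_controls U) T x (\<lambda>t. lift_control (u t))"
proof -
  have u: "u \<in> borel_measurable (lebesgue_on (time_dom T))" and uU: "\<And>t. t \<in> time_dom T \<Longrightarrow> u t \<in> U"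
    and xC: "\<And>t. t \<in> time_dom T \<Longrightarrow> x t \<in> - C"
    and ode: "AE t in lebesgue_on (time_dom T).
        (x has_vector_derivative rescaled_dyn f \<nu> (x t) (u t)) (at t within time_dom T)"
    using adm by (auto simp: admissible_pair_def Linf_loc_def)
  have "(\<lambda>t. lift_control (u t)) \<in> Linf_loc (time_dom T) (ext_controls U)"
    unfolding Linf_loc_def
    using measurable_compose[OF u borel_measurable_lift_control] uU \<open>cone U\<close> norm_lift_control_le
    by (auto intro!: exI[of _ 2] lift_control_in_ext_controls)
  moreover have "AE t in lebesgue_on (time_dom T).
      (x has_vector_derivative ext_dyn C f \<nu> (x t) (lift_control (u t))) (at t within time_dom T)"
    \<comment> \<open>\<open>AE_space\<close> supplies \<open>t \<in> time_dom T\<close>, which puts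
      \<open>u t\<close> in \<open>U\<close> and \<open>x t\<close> outside \<open>C\<close>, as the
      pointwise identity requires.\<close>
    using ode AE_space
  proof eventually_elim
    case (elim t)
    then have "t \<in> time_dom T" by simp
    with elim show ?case
      using ext_dyn_lift_control[OF \<open>cone U\<close> uU xC cont[OF xC]] by simp
  qed
  ultimately show ?thesis
    using adm by (simp add: admissible_pair_def)
qed

end

theorem proposition3p1:
  fixes C :: "(real ^ 'n) set" and U :: "(real ^ 'm) set"
    and f :: "real ^ 'n \<Rightarrow> real ^ 'm \<Rightarrow> real ^ 'n" and \<nu> :: "real \<Rightarrow> real"
  assumes "C \<noteq> {}" and "closed C" and "compact (frontier C)"
    and "U \<noteq> {}" and "closed U" and "cone U"
    and "continuous_on ((- C) \<times> U) (\<lambda>(x, u). f x u)"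
    and "Hg C U f \<nu>"
    and "GAC C (rescaled_dyn f \<nu>) U"
  shows "GAC C (ext_dyn C f \<nu>) (ext_controls U)"
proof -
  have growth: "growth_rate \<nu>" using \<open>Hg C U f \<nu>\<close> by (simp add: Hg_def)
  have cont: "continuous_on U (rescaled_dyn f \<nu> x)" if "x \<in> - C" for x
  proof -
    \<comment> \<open>The uniform continuity in \<open>Hg\<close> is used with the singleton
      \<open>{x}\<close> as compact set.\<close>
    have "uniformly_continuous_on ({x} \<times> U) (\<lambda>(x, u). rescaled_dyn f \<nu> x u)"
      using \<open>Hg C U f \<nu>\<close> that unfolding Hg_def by (metis compact_sing empty_subsetI insert_subset)
    then have "continuous_on ({x} \<times> U) (\<lambda>(x, u). rescaled_dyn f \<nu> x u)"
      by (rule uniformly_continuous_imp_continuous)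
    then have "continuous_on U (\<lambda>u. (\<lambda>(x, u). rescaled_dyn f \<nu> x u) (x, u))"
      by (rule continuous_on_compose2) (auto intro!: continuous_intros)
    then show ?thesis by simp
  qed
  \<comment> \<open>The body of \<open>GAC\<close> for a fixed rate, so that the same
    \<open>\<beta>\<close> can be carried from one system to the other.\<close>
  let ?desc = "\<lambda>\<beta> g V. \<forall>z\<in>- C. \<exists>T x u. admissible_pair C g V T x u \<and> extended_after C T x \<and>
      x 0 = z \<and> (\<forall>t\<ge>0. infdist (x t) C \<le> \<beta> (infdist z C) t)"
  obtain \<beta> where "KL_fun \<beta>" and \<beta>: "?desc \<beta> (rescaled_dyn f \<nu>) U"
    using \<open>GAC C (rescaled_dyn f \<nu>) U\<close> unfolding GAC_def by (elim exE conjE)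
  have "?desc \<beta> (ext_dyn C f \<nu>) (ext_controls U)"
  proof
    fix z assume "z \<in> - C"
    with \<beta> obtain T x u where adm: "admissible_pair C (rescaled_dyn f \<nu>) U T x u"
      and rest: "extended_after C T x \<and> x 0 = z \<and> (\<forall>t\<ge>0. infdist (x t) C \<le> \<beta> (infdist z C) t)"
      by (elim ballE exE conjE) blast+
    show "\<exists>T x u. admissible_pair C (ext_dyn C f \<nu>) (ext_controls U) T x u \<and>
        extended_after C T x \<and> x 0 = z \<and> (\<forall>t\<ge>0. infdist (x t) C \<le> \<beta> (infdist z C) t)"
      \<comment> \<open>The conditions in \<open>rest\<close> do not mention the control, so they
        carry over verbatim.\<close>
      by (rule exI, rule exI, rule exI, rule conjI[OF
          admissible_pair_lift_control[OF growth \<open>cone U\<close> cont adm] rest])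
  qed
  with \<open>KL_fun \<beta>\<close> show ?thesis
    unfolding GAC_def by (intro exI[of _ \<beta>] conjI)
qed

end
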